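(* If $0<q<1$, then $$\frac{\sqrt{1+8xq}-(1+2q)}{2q^2}< Z_q^*(x)\le \frac{\sqrt{1+8xq}-1}{2q},\qquad x\ge \frac{\Gamma_q(3)}{2\Gamma_q(1)}.$$
   Context: $N=\{1,2,3,\dots\}$ denotes the set of positive integers. For $0<q<1$, the $q$-gamma function is $$\Gamma_q(x)=\frac{(q;q)_\infty}{(q^x;q)_\infty}(1-q)^{1-x},\qquad (a;q)_\infty=\prod_{n=0}^\infty(1-aq^n).$$ For $0<q<1$ and $x\in\left[\frac{\Gamma_q(3)}{2\Gamma_q(1)},\infty\right)$ define $$Z_q^*(x)=\max\left\{\frac{1-q^m}{1-q}: m\in N,\ \frac{\Gamma_q(m+2)}{2\Gamma_q(m)}\le x\right\}.$$
   Formalization: The bounds are proved for those x at which the maximum defining Z_q^*(x) exists, i.e. x < 1/(2(1-q)^2); for larger x every m is admissible and the maximum is not attained, and the lower bound fails even if max is read as supremum. *)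

theory Defs
  imports "HOL-Analysis.Analysis"
begin

definition qpoch_inf :: "real \<Rightarrow> real \<Rightarrow> real" where
  "qpoch_inf a q = (\<Prod>n. 1 - a * q ^ n)"

definition q_Gamma :: "real \<Rightarrow> real \<Rightarrow> real" where
  "q_Gamma q x = qpoch_inf q q / qpoch_inf (q powr x) q * (1 - q) powr (1 - x)"

definition Z_star_set :: "real \<Rightarrow> real \<Rightarrow> real set" where
  "Z_star_set q x =
     {(1 - q ^ m) / (1 - q) | m :: nat.
        m \<ge> 1 \<and> q_Gamma q (real m + 2) / (2 * q_Gamma q (real m)) \<le> x}"

(* A genuine maximum, as an element of the set: unlike Max it does not presuppose that the
   set is finite, and unlike Sup it is specified only if the largest element is attained. *)
definition Z_star :: "real \<Rightarrow> real \<Rightarrow> real" where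
  "Z_star q x = (GREATEST z. z \<in> Z_star_set q x)"

(* The maximum need not exist: once x is at least the limit 1 / (2 (1 - q)^2) of the increasing
   sequence Gamma_q(m+2) / (2 Gamma_q(m)), every m is admissible and the supremum 1 / (1 - q)
   is not attained.  Lemma Z_star_defined_iff below determines the domain of Z_star exactly. *)
definition Z_star_defined :: "real \<Rightarrow> real \<Rightarrow> bool" where
  "Z_star_defined q x \<longleftrightarrow> (\<exists>z \<in> Z_star_set q x. \<forall>y \<in> Z_star_set q x. y \<le> z)"

lemma convergent_qpoch:
  fixes a q :: real
  assumes "0 < q" "q < 1"
  shows "convergent_prod (\<lambda>n. 1 - a * q ^ n)"
proof (rule abs_convergent_prod_imp_convergent_prod, rule summable_imp_abs_convergent_prod)
  have "summable (\<lambda>n. \<bar>a\<bar> * q ^ n)"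
    using assms by (intro summable_mult summable_geometric) auto
  then show "summable (\<lambda>n. norm (1 - a * q ^ n - 1))"
    using assms by (simp add: abs_mult)
qed

lemma qpoch_inf_pos:
  assumes "0 < q" "q < 1" "a < 1"
  shows "qpoch_inf a q > 0"
  unfolding qpoch_inf_def
proof (rule less_0_prodinf)
  show "convergent_prod (\<lambda>n. 1 - a * q ^ n)" using assms convergent_qpoch by blast
  fix i
  have p: "0 < q ^ i" "q ^ i \<le> 1" using assms by (auto simp: power_le_one)
  have "a * q ^ i < 1"
  proof (cases "a \<le> 0")
    case True
    then have "a * q ^ i \<le> 0" using p by (simp add: mult_nonpos_nonneg)
    then show ?thesis by simp
  next
    case False
    then have "a * q ^ i \<le> a * 1" using p by (intro mult_left_mono) auto
    then show ?thesis using assms by simp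
  qed
  then show "0 < 1 - a * q ^ i" by simp
qed

lemma qpoch_inf_rec:
  assumes "0 < q" "q < 1" "a < 1"
  shows "qpoch_inf a q = (1 - a) * qpoch_inf (a * q) q"
proof -
  have nz: "1 - a * q ^ i \<noteq> 0" for i
    using prodinf_nonzero assms
    by (smt (verit) mult_le_cancel_left1 mult_nonneg_nonneg mult_nonpos_nonneg power_le_one zero_le_power mult_left_le)
  have "(\<Prod>n. 1 - a * q ^ Suc n) = (\<Prod>n. 1 - a * q ^ n) / (1 - a * q ^ 0)"
    by (rule prodinf_split_head) (use nz convergent_qpoch assms in auto)
  then show ?thesis
    using assms by (simp add: qpoch_inf_def mult.assoc field_simps)
qed

lemma q_Gamma_rec:
  assumes "0 < q" "q < 1" "0 < x"
  shows "q_Gamma q (x + 1) = (1 - q powr x) / (1 - q) * q_Gamma q x"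
proof -
  have lt: "q powr x < 1" using assms by (simp add: powr01_less_one)
  have "q powr (x + 1) = q powr x * q" using assms by (simp add: powr_add)
  moreover have "(1 - q) powr (1 - x) = (1 - q) * (1 - q) powr (1 - (x + 1))"
    using assms powr_add[of "1 - q" 1 "- x"] by simp
  moreover have "qpoch_inf (q powr x * q) q > 0"
    using assms lt mult_strict_mono[of "q powr x" 1 q 1] by (intro qpoch_inf_pos) auto
  moreover have "g / p * w = b / c * (g / (b * p) * (c * w))"
    if "b > 0" "c > 0" for b c g p w :: real
    using that by simp
  ultimately show ?thesis
    using qpoch_inf_rec[OF assms(1,2) lt] lt assms(2) by (simp add: q_Gamma_def)
qed

lemma q_Gamma_pos:
  assumes "0 < q" "q < 1" "0 < x"
  shows "q_Gamma q x > 0"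
  using assms unfolding q_Gamma_def
  by (intro mult_pos_pos divide_pos_pos qpoch_inf_pos) (auto simp: powr01_less_one)

lemma q_Gamma_ratio:
  assumes "0 < q" "q < 1" "m \<ge> 1"
  shows "q_Gamma q (real m + 2) / (2 * q_Gamma q (real m))
         = (1 - q ^ m) * (1 - q ^ Suc m) / (2 * (1 - q)\<^sup>2)"
proof -
  have "q_Gamma q (real m + 2) = (1 - q powr (real (Suc m))) / (1 - q) * q_Gamma q (real m + 1)"
    using q_Gamma_rec[of q "real m + 1"] assms by (simp add: add.commute)
  moreover have "q_Gamma q (real m + 1) = (1 - q powr real m) / (1 - q) * q_Gamma q (real m)"
    using q_Gamma_rec[of q "real m"] assms by simp
  moreover have "q_Gamma q (real m) > 0" using assms by (intro q_Gamma_pos) auto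
  moreover have "q powr real m = q ^ m" "q powr real (Suc m) = q ^ Suc m"
    using assms by (auto simp: powr_realpow simp del: power_Suc of_nat_Suc)
  moreover have "(b / c * (a / c * g)) / (2 * g) = a * b / (2 * c\<^sup>2)" if "g > 0"
    for a b c g :: real
    using that by (simp add: power2_eq_square mult_ac)
  ultimately show ?thesis by (simp only:)
qed

lemma Z_star_defined_iff:
  assumes q: "0 < q" "q < 1" and x: "x \<ge> q_Gamma q 3 / (2 * q_Gamma q 1)"
  shows "Z_star_defined q x \<longleftrightarrow> x < 1 / (2 * (1 - q)\<^sup>2)"
proof -
  define T where "T m = (1 - q ^ m) * (1 - q ^ Suc m) / (2 * (1 - q)\<^sup>2)" for m
  have S: "Z_star_set q x = (\<lambda>m. (1 - q ^ m) / (1 - q)) ` {m. m \<ge> 1 \<and> T m \<le> x}"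
    using q_Gamma_ratio[OF q] by (auto simp: Z_star_set_def T_def)
  have ne: "Z_star_set q x \<noteq> {}"
  proof -
    have "T 1 \<le> x" using x q_Gamma_ratio[OF q, of 1] by (simp add: T_def)
    then show ?thesis unfolding S by auto
  qed
  have lim: "T \<longlonglongrightarrow> (1 - 0) * (1 - 0) / (2 * (1 - q)\<^sup>2)"
    unfolding T_def using q
    by (intro tendsto_intros LIMSEQ_power_zero LIMSEQ_Suc) auto
  show ?thesis
  proof
    assume lt: "x < 1 / (2 * (1 - q)\<^sup>2)"
    then have "\<forall>\<^sub>F m in sequentially. T m > x" using order_tendstoD(1)[OF lim] by simp
    then obtain M where M: "\<And>m. m \<ge> M \<Longrightarrow> T m > x" by (auto simp: eventually_sequentially)
    have "{m. m \<ge> 1 \<and> T m \<le> x} \<subseteq> {..<M}" using M by (auto simp: not_le[symmetric])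
    then have "finite (Z_star_set q x)" unfolding S using finite_subset by blast
    then show "Z_star_defined q x"
      unfolding Z_star_defined_def using ne Max_in Max_ge by blast
  next
    assume d: "Z_star_defined q x"
    show "x < 1 / (2 * (1 - q)\<^sup>2)"
    proof (rule ccontr)
      assume "\<not> ?thesis"
      then have ge: "1 / (2 * (1 - q)\<^sup>2) \<le> x" by simp
      have all: "T m \<le> x" for m
      proof -
        have "(1 - q ^ m) * (1 - q ^ Suc m) \<le> 1 * 1"
          using q power_le_one[of q m] power_le_one[of q "Suc m"]
          by (intro mult_mono) (auto simp del: power_Suc)
        then have "T m \<le> 1 / (2 * (1 - q)\<^sup>2)"
          unfolding T_def by (intro divide_right_mono) auto
        then show ?thesis using ge by simp
      qed
      from d obtain m where m: "m \<ge> 1"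
        and "\<forall>y \<in> Z_star_set q x. y \<le> (1 - q ^ m) / (1 - q)"
        unfolding Z_star_defined_def S by auto
      then have "(1 - q ^ Suc m) / (1 - q) \<le> (1 - q ^ m) / (1 - q)"
        using all unfolding S by (auto simp del: power_Suc)
      moreover have "q ^ Suc m < q ^ m" using q by simp
      ultimately show False using q by (simp add: divide_le_cancel del: power_Suc)
    qed
  qed
qed

end

(* Write [m] = (1 - q^m) / (1 - q), so that Gamma_q(m+2) / (2 Gamma_q(m)) = [m] [m+1] / 2 and
   [m+1] = 1 + q [m].  The condition on m is thus the quadratic inequality [m] (1 + q [m]) <= 2 x.
   Solving it for z = [m] maximal gives the upper bound; solving its negation for
   [m+1] = 1 + q z gives the lower bound. *)
theory Submission
  imports Defs
begin

lemma q_number_Suc: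
  fixes q :: real
  assumes "q < 1"
  shows "(1 - q ^ Suc m) / (1 - q) = 1 + q * ((1 - q ^ m) / (1 - q))"
  using assms by (simp add: field_simps)

lemma q_Gamma_ratio_q_number:
  assumes "0 < q" "q < 1" "m \<ge> 1"
  defines "z \<equiv> (1 - q ^ m) / (1 - q)"
  shows "q_Gamma q (real m + 2) / (2 * q_Gamma q (real m)) = z * (1 + q * z) / 2"
  using assms(2) q_Gamma_ratio[OF assms(1-3)] q_number_Suc[OF assms(2), of m, symmetric]
  by (simp add: z_def power2_eq_square)

text \<open>Completing the square: multiplying by \<open>8 * q\<close> and adding 1 turns the left
  side into \<open>(2 * q * z + 1)\<^sup>2\<close>.\<close>

lemma quadratic_le_iff_le_root:
  fixes q x z :: real
  assumes "0 < q" "0 \<le> z"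
  shows "z * (1 + q * z) / 2 \<le> x \<longleftrightarrow> z \<le> (sqrt (1 + 8 * x * q) - 1) / (2 * q)"
proof -
  have "z \<le> (sqrt (1 + 8 * x * q) - 1) / (2 * q) \<longleftrightarrow> 2 * q * z + 1 \<le> sqrt (1 + 8 * x * q)"
    using assms by (simp add: field_simps)
  \<comment> \<open>No sign condition on the radicand: \<open>sqrt\<close> is odd, so for a negative
    radicand both sides are false, as \<open>2 * q * z + 1\<close> is positive.\<close>
  also have "\<dots> \<longleftrightarrow> (2 * q * z + 1)\<^sup>2 \<le> 1 + 8 * x * q"
    using assms by (auto intro: real_le_rsqrt sqrt_ge_absD)
  also have "\<dots> \<longleftrightarrow> (4 * q) * (z * (1 + q * z)) \<le> (4 * q) * (2 * x)"
    by (simp add: power2_eq_square algebra_simps)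
  also have "\<dots> \<longleftrightarrow> z * (1 + q * z) \<le> 2 * x"
    using assms by (subst mult_le_cancel_left_pos) auto
  finally show ?thesis by (simp add: mult.commute)
qed

text \<open>\<open>GREATEST\<close> is a mere description; an attained maximum pins it down.\<close>

lemma Z_star_greatest:
  assumes "Z_star_defined q x"
  shows "Z_star q x \<in> Z_star_set q x" and "y \<in> Z_star_set q x \<Longrightarrow> y \<le> Z_star q x"
proof -
  obtain z where z: "z \<in> Z_star_set q x" "\<forall>y \<in> Z_star_set q x. y \<le> z"
    using assms unfolding Z_star_defined_def by blast
  then have "Z_star q x = z"
    unfolding Z_star_def by (intro Greatest_equality) auto
  then show "Z_star q x \<in> Z_star_set q x" "y \<in> Z_star_set q x \<Longrightarrow> y \<le> Z_star q x"
    using z by auto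
qed

theorem theorem2p1:
  fixes q x :: real
  assumes "0 < q" and "q < 1"
    and "x \<ge> q_Gamma q 3 / (2 * q_Gamma q 1)"
    and "Z_star_defined q x"
  shows "(sqrt (1 + 8 * x * q) - (1 + 2 * q)) / (2 * q\<^sup>2) < Z_star q x
    \<and> Z_star q x \<le> (sqrt (1 + 8 * x * q) - 1) / (2 * q)"
proof -
  define R where "R = (sqrt (1 + 8 * x * q) - 1) / (2 * q)"
  have nonneg: "0 \<le> (1 - q ^ m) / (1 - q)" for m
    using assms by (simp add: power_le_one)
  have mem: "(1 - q ^ m) / (1 - q) \<in> Z_star_set q x \<longleftrightarrow> (1 - q ^ m) / (1 - q) \<le> R"
    if "m \<ge> 1" for m
  proof -
    \<comment> \<open>Stated for every index \<open>k\<close>, since membership in the set only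
      yields some index with the same value, not \<open>m\<close> itself.\<close>
    have eq: "q_Gamma q (real k + 2) / (2 * q_Gamma q (real k)) \<le> x \<longleftrightarrow> (1 - q ^ k) / (1 - q) \<le> R"
      if "k \<ge> 1" for k
      unfolding R_def q_Gamma_ratio_q_number[OF assms(1,2) that]
      by (rule quadratic_le_iff_le_root[OF assms(1) nonneg])
    show ?thesis
      unfolding Z_star_set_def using eq that by fastforce
  qed
  obtain m where m: "m \<ge> 1" "Z_star q x = (1 - q ^ m) / (1 - q)"
    using Z_star_greatest(1)[OF assms(4)] by (auto simp: Z_star_set_def)
  have upper: "Z_star q x \<le> R"
    using mem[OF m(1)] Z_star_greatest(1)[OF assms(4)] m(2) by simp
  have "Z_star q x < (1 - q ^ Suc m) / (1 - q)"
    unfolding m(2) using assms by (simp add: divide_strict_right_mono)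
  \<comment> \<open>The next q-number exceeds the maximum, so it is not in the set and must lie
    beyond the threshold \<open>R\<close>; this makes the lower bound strict.\<close>
  then have "R < (1 - q ^ Suc m) / (1 - q)"
    using mem[of "Suc m"] Z_star_greatest(2)[OF assms(4)] by (force simp: not_le[symmetric] simp del: power_Suc)
  also have "\<dots> = 1 + q * Z_star q x"
    unfolding m(2) by (rule q_number_Suc[OF assms(2)])
  finally have "(R - 1) / q < Z_star q x"
    using assms by (simp add: field_simps)
  moreover have "(R - 1) / q = (sqrt (1 + 8 * x * q) - (1 + 2 * q)) / (2 * q\<^sup>2)"
    using assms unfolding R_def by (simp add: power2_eq_square field_simps)
  ultimately show ?thesis
    using upper unfolding R_def by simp
qed

end
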